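(* Let $X$ be a Tychonoff space. Every continuous linear operator $T:C_p(X)\to(c_{00})_p$ has finite-dimensional range.
   Context: All vector spaces are real. For a Tychonoff (completely regular Hausdorff) space $X$, $C_p(X)$ is the vector space $C(X)$ of all continuous real-valued functions on $X$ with the topology of pointwise convergence. $c_{00}$ is the space of real sequences indexed by $\mathbb{N}$ with only finitely many non-zero terms, and $(c_{00})_p$ denotes $c_{00}$ with the subspace topology inherited from the product space $\mathbb{R}^{\mathbb{N}}$. *)

theory Defs
  imports "HOL-Analysis.Analysis" "HOL-Library.Function_Algebras"
begin

text \<open>Pointwise scalar multiplication, complementing the pointwise additive structure of
  \<^theory>\<open>HOL-Library.Function_Algebras\<close>; it makes \<^typ>\<open>nat \<Rightarrow> real\<close> a real vector space.\<close>

instantiation "fun" :: (type, real_vector) real_vector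
begin

definition scaleR_fun :: "real \<Rightarrow> ('a \<Rightarrow> 'b) \<Rightarrow> 'a \<Rightarrow> 'b"
  where "scaleR_fun c f = (\<lambda>x. c *\<^sub>R f x)"

instance
  by standard
    (simp_all add: scaleR_fun_def plus_fun_def fun_eq_iff scaleR_add_right scaleR_add_left)

end

definition tychonoff_space :: "'a topology \<Rightarrow> bool"
  where "tychonoff_space X \<longleftrightarrow> completely_regular_space X \<and> Hausdorff_space X"

text \<open>A continuous function on \<open>X\<close> is represented by its extensional version (\<open>undefined\<close> off the
  carrier), as in \<^const>\<open>product_topology\<close>; hence the vector space operations on \<open>C(X)\<close> are the
  pointwise operations restricted to the carrier.\<close>

definition C_space :: "'a topology \<Rightarrow> ('a \<Rightarrow> real) set"
  where "C_space X = {f \<in> extensional (topspace X). continuous_map X euclideanreal f}"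

definition Cp :: "'a topology \<Rightarrow> ('a \<Rightarrow> real) topology"
  where "Cp X = subtopology (product_topology (\<lambda>_. euclideanreal) (topspace X)) (C_space X)"

definition C_add :: "'a topology \<Rightarrow> ('a \<Rightarrow> real) \<Rightarrow> ('a \<Rightarrow> real) \<Rightarrow> 'a \<Rightarrow> real"
  where "C_add X f g = (\<lambda>x\<in>topspace X. f x + g x)"

definition C_scale :: "'a topology \<Rightarrow> real \<Rightarrow> ('a \<Rightarrow> real) \<Rightarrow> 'a \<Rightarrow> real"
  where "C_scale X c f = (\<lambda>x\<in>topspace X. c * f x)"

definition linear_on_C :: "'a topology \<Rightarrow> (('a \<Rightarrow> real) \<Rightarrow> 'b::real_vector) \<Rightarrow> bool"
  where "linear_on_C X T \<longleftrightarrow>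
    (\<forall>f\<in>C_space X. \<forall>g\<in>C_space X. T (C_add X f g) = T f + T g) \<and>
    (\<forall>c. \<forall>f\<in>C_space X. T (C_scale X c f) = c *\<^sub>R T f)"

definition c00 :: "(nat \<Rightarrow> real) set"
  where "c00 = {s. finite {n. s n \<noteq> 0}}"

definition c00_p :: "(nat \<Rightarrow> real) topology"
  where "c00_p = subtopology (product_topology (\<lambda>_. euclideanreal) UNIV) c00"

definition finite_dimensional :: "'b::real_vector set \<Rightarrow> bool"
  where "finite_dimensional V \<longleftrightarrow> (\<exists>B. finite B \<and> span B = V)"

lemma topspace_Cp [simp]: "topspace (Cp X) = C_space X"
  by (auto simp: Cp_def C_space_def PiE_def)

lemma topspace_c00_p [simp]: "topspace c00_p = c00"
  by (simp add: c00_p_def)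

lemma C_add_closed: "f \<in> C_space X \<Longrightarrow> g \<in> C_space X \<Longrightarrow> C_add X f g \<in> C_space X"
  unfolding C_space_def C_add_def
  by (auto intro: continuous_map_eq [OF continuous_map_add])

lemma C_scale_closed: "f \<in> C_space X \<Longrightarrow> C_scale X c f \<in> C_space X"
  unfolding C_space_def C_scale_def
  by (auto intro: continuous_map_eq [OF continuous_map_real_mult_left])

lemma subspace_c00: "subspace c00"
proof (rule subspaceI)
  show "0 \<in> c00" by (simp add: c00_def)
  show "s + t \<in> c00" if "s \<in> c00" "t \<in> c00" for s t
    using that unfolding c00_def
    by (auto intro: finite_subset [of _ "{n. s n \<noteq> 0} \<union> {n. t n \<noteq> 0}"])
  show "c *\<^sub>R s \<in> c00" if "s \<in> c00" for c s
    using that unfolding c00_def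
    by (auto simp: scaleR_fun_def intro: finite_subset [of _ "{n. s n \<noteq> 0}"])
qed

end

theory Submission
  imports Defs
begin

text \<open>
  Write \<open>\<phi> n f\<close> for the \<open>n\<close>-th coordinate of \<open>T f\<close>; each \<open>\<phi> n\<close> is a continuous linear functional
  on \<open>C\<^sub>p(X)\<close>, and for each \<open>f\<close> all but finitely many \<open>\<phi> n f\<close> vanish. The point is that the number of
  exceptions is bounded uniformly in \<open>f\<close>: there is one \<open>N\<close> such that every \<open>\<phi> n\<close> with \<open>n \<ge> N\<close> is
  identically zero. Then the range of \<open>T\<close> lies in the span of the first \<open>N\<close> unit sequences.

  The space \<open>C\<^sub>p(X)\<close> is in general not a Baire space, so a category argument cannot be run
  there directly. The bounded continuous functions with the supremum metric do form a complete
  space, and its topology is finer than that of pointwise convergence, so the \<open>\<phi> n\<close> remain continuous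
  on it. The countably many closed linear subspaces
  \<open>{f. \<forall>n\<ge>N. \<phi> n f = 0}\<close> cover it, so by Baire's theorem one of
  them has an interior point, and a linear subspace with an interior point is everything
  (\<open>eventually_zero_on_bounded\<close>). Finally, each continuous function is the pointwise limit of its
  truncations, which are bounded; so the \<open>\<phi> n\<close> with \<open>n \<ge> N\<close> vanish on all of \<open>C(X)\<close>
  (\<open>zero_if_zero_on_bounded\<close>).
\<close>

section \<open>Bounded continuous functions\<close>

abbreviation Cb :: "'a topology \<Rightarrow> ('a \<Rightarrow> real) metric"
  where "Cb X \<equiv> cfunspace X euclidean_metric"

lemma mspace_Cb: "mspace (Cb X) = {f \<in> C_space X. bounded (f ` topspace X)}"
  by (auto simp: C_space_def)

lemma Cb_add:
  assumes "f \<in> mspace (Cb X)" "g \<in> mspace (Cb X)"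
  shows "C_add X f g \<in> mspace (Cb X)"
proof -
  have "bounded ((\<lambda>x. f x + g x) ` topspace X)"
    using assms unfolding mspace_Cb by (auto intro: bounded_plus_comp)
  moreover have "C_add X f g ` topspace X = (\<lambda>x. f x + g x) ` topspace X"
    by (auto simp: C_add_def)
  ultimately show ?thesis
    using assms unfolding mspace_Cb by (auto intro: C_add_closed)
qed

lemma Cb_scale:
  assumes "f \<in> mspace (Cb X)"
  shows "C_scale X c f \<in> mspace (Cb X)"
proof -
  have "bounded ((\<lambda>y. c *\<^sub>R y) ` f ` topspace X)"
    using assms unfolding mspace_Cb by (intro bounded_scaling) auto
  moreover have "C_scale X c f ` topspace X = (\<lambda>y. c *\<^sub>R y) ` f ` topspace X"
    by (force simp: C_scale_def)
  ultimately show ?thesis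
    using assms unfolding mspace_Cb by (auto intro: C_scale_closed)
qed

lemma zero_in_Cb: "(\<lambda>x\<in>topspace X. 0) \<in> mspace (Cb X)"
proof -
  have "continuous_map X euclideanreal (\<lambda>x\<in>topspace X. 0)"
    by (rule continuous_map_eq[of X euclideanreal "\<lambda>_. 0"]) auto
  moreover have "bounded ((\<lambda>x\<in>topspace X. 0::real) ` topspace X)"
    by (rule boundedI[of _ 0]) auto
  ultimately show ?thesis
    unfolding mspace_Cb by (auto simp: C_space_def)
qed

lemma mcomplete_Cb: "mcomplete_of (Cb X)"
proof -
  have "Met_TC.mcomplete TYPE(real)"
    by (simp add: complete_UNIV)
  from Met_TC.mcomplete_cfunspace[OF this, of X] show ?thesis
    by (simp add: Met_TC.Self_def euclidean_metric_def)
qed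

lemma dist_le_mdist_Cb:
  assumes "f \<in> mspace (Cb X)" "g \<in> mspace (Cb X)" "x \<in> topspace X"
  shows "dist (f x) (g x) \<le> mdist (Cb X) f g"
  using mdist_cfunspace_imp_mdist_le[OF assms(1,2) order_refl assms(3)] by simp

text \<open>Evaluation at each point is continuous for the supremum metric by the previous lemma; thus
  functionals that are continuous for pointwise convergence are continuous on a complete space.\<close>

lemma continuous_map_Cb_Cp: "continuous_map (mtopology_of (Cb X)) (Cp X) (\<lambda>f. f)"
proof -
  interpret M: Metric_space "mspace (Cb X)" "mdist (Cb X)"
    by (rule Metric_space_mspace_mdist)
  have "continuous_map M.mtopology euclidean (\<lambda>f. f x)" if x: "x \<in> topspace X" for x
    unfolding mtopology_is_euclidean[symmetric]
      M.metric_continuous_map[OF Met_TC.Metric_space_axioms]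
    using dist_le_mdist_Cb[OF _ _ x] by (metis le_less_trans subset_UNIV)
  moreover have "mspace (Cb X) \<subseteq> C_space X" "mspace (Cb X) \<subseteq> extensional (topspace X)"
    by (auto simp: C_space_def)
  ultimately show ?thesis
    unfolding Cp_def mtopology_of_def
    by (auto simp: continuous_map_in_subtopology continuous_map_componentwise simp del: mspace_cfunspace)
qed

section \<open>Pointwise eventually vanishing functionals\<close>

text \<open>The Baire step. If \<open>f\<close> is an interior point of one of the covering subspaces and \<open>g\<close> is any
  bounded continuous function, then \<open>f + t g\<close> still lies in that subspace for some \<open>t > 0\<close>, and
  subtracting \<open>f\<close> and dividing by \<open>t\<close> puts \<open>g\<close> in it.\<close>

lemma eventually_zero_on_bounded:
  fixes \<phi> :: "nat \<Rightarrow> ('a \<Rightarrow> real) \<Rightarrow> real"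
  assumes lin: "\<And>n. linear_on_C X (\<phi> n)"
    and cont: "\<And>n. continuous_map (Cp X) euclideanreal (\<phi> n)"
    and ev: "\<And>f. f \<in> mspace (Cb X) \<Longrightarrow> eventually (\<lambda>n. \<phi> n f = 0) sequentially"
  shows "\<exists>N. \<forall>n\<ge>N. \<forall>f\<in>mspace (Cb X). \<phi> n f = 0"
proof -
  interpret M: Metric_space "mspace (Cb X)" "mdist (Cb X)"
    by (rule Metric_space_mspace_mdist)
  define Z where "Z N = {f \<in> mspace (Cb X). \<forall>n\<ge>N. \<phi> n f = 0}" for N
  have contM: "continuous_map M.mtopology euclideanreal (\<phi> n)" for n
    using continuous_map_compose[OF continuous_map_Cb_Cp cont]
    by (simp add: o_def mtopology_of_def)
  have closed: "closedin M.mtopology (Z N)" for N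
  proof -
    have "closedin M.mtopology {f \<in> mspace (Cb X). \<phi> n f \<in> {0}}" for n
      using closedin_continuous_map_preimage[OF contM, of "{0}"]
      by (simp del: mspace_cfunspace)
    then have "closedin M.mtopology (\<Inter>n\<in>{N..}. {f \<in> mspace (Cb X). \<phi> n f \<in> {0}})"
      by (intro closedin_INT) auto
    also have "(\<Inter>n\<in>{N..}. {f \<in> mspace (Cb X). \<phi> n f \<in> {0}}) = Z N"
      unfolding Z_def by auto
    finally show ?thesis .
  qed
  have cover: "(\<Union>N. Z N) = mspace (Cb X)"
    using ev unfolding Z_def eventually_sequentially by blast
  have "\<exists>N. M.mtopology interior_of (Z N) \<noteq> {}"
  proof (rule ccontr)
    assume "\<nexists>N. M.mtopology interior_of (Z N) \<noteq> {}"
    then have "M.mtopology interior_of (\<Union>(range Z)) = {}"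
      using closed mcomplete_Cb[of X] unfolding mcomplete_of_def
      by (intro M.metric_Baire_category_alt) auto
    then have "mspace (Cb X) = {}"
      unfolding cover by (metis M.topspace_mtopology interior_of_topspace)
    then show False
      using zero_in_Cb by blast
  qed
  then obtain N f r where f: "f \<in> mspace (Cb X)" and r: "r > 0" and ball: "M.mball f r \<subseteq> Z N"
    unfolding M.metric_interior_of by blast
  have "\<phi> n g = 0" if n: "n \<ge> N" and g: "g \<in> mspace (Cb X)" for n g
  proof -
    obtain B where B: "B > 0" "\<And>x. x \<in> topspace X \<Longrightarrow> \<bar>g x\<bar> \<le> B"
      using g unfolding mspace_Cb bounded_pos by auto
    \<comment> \<open>The scalar \<open>t\<close> is chosen so that \<open>f + t g\<close> has distance at most \<open>r / 2\<close> from \<open>f\<close>.\<close>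
    define t where "t = r / (2 * B)"
    have t: "t > 0"
      using r B by (simp add: t_def)
    define h where "h = C_add X f (C_scale X t g)"
    have h: "h \<in> mspace (Cb X)"
      unfolding h_def by (intro Cb_add Cb_scale f g)
    have "mdist (Cb X) f h \<le> r / 2"
    proof (rule mdist_cfunspace_le)
      fix x assume x: "x \<in> topspace X"
      have "dist (f x) (h x) = t * \<bar>g x\<bar>"
        using x t by (simp add: h_def C_add_def C_scale_def dist_real_def abs_mult)
      also have "\<dots> \<le> t * B"
        using B(2)[OF x] t by simp
      also have "\<dots> = r / 2"
        using B by (simp add: t_def)
      finally show "mdist euclidean_metric (f x) (h x) \<le> r / 2"
        by simp
    qed (use r in simp)
    then have "h \<in> M.mball f r" "f \<in> M.mball f r"
      using f h r by (auto simp del: mspace_cfunspace)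
    then have "\<phi> n h = 0" "\<phi> n f = 0"
      using ball n unfolding Z_def by auto
    moreover have "\<phi> n h = \<phi> n f + t * \<phi> n g"
      using lin[of n] f g unfolding linear_on_C_def h_def mspace_Cb
      by (simp add: C_scale_closed)
    ultimately show ?thesis
      using t by simp
  qed
  then show ?thesis
    by blast
qed

text \<open>The bounded functions are dense in \<open>C\<^sub>p(X)\<close>: at any given point, the truncations of \<open>f\<close> to
  \<open>[-k, k]\<close> agree with \<open>f\<close> as soon as \<open>k\<close> is at least the absolute value of \<open>f\<close> there.\<close>

lemma zero_if_zero_on_bounded:
  fixes \<phi> :: "('a \<Rightarrow> real) \<Rightarrow> real"
  assumes cont: "continuous_map (Cp X) euclideanreal \<phi>"
    and zero: "\<And>f. f \<in> mspace (Cb X) \<Longrightarrow> \<phi> f = 0"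
    and f: "f \<in> C_space X"
  shows "\<phi> f = 0"
proof -
  define u where "u k = (\<lambda>x\<in>topspace X. max (- real k) (min (real k) (f x)))" for k
  have uC: "u k \<in> C_space X" for k
  proof -
    have "continuous_map X euclideanreal (\<lambda>x. max (- real k) (min (real k) (f x)))"
      using f by (intro continuous_intros) (auto simp: C_space_def)
    then have "continuous_map X euclideanreal (u k)"
      by (rule continuous_map_eq) (simp add: u_def)
    then show ?thesis
      by (simp add: C_space_def u_def)
  qed
  have "bounded (u k ` topspace X)" for k
    by (rule boundedI[of _ "real k"]) (auto simp: u_def)
  then have zero_u: "\<phi> (u k) = 0" for k
    using uC by (intro zero) (simp add: mspace_Cb del: mspace_cfunspace)
  have "(\<lambda>k. u k x) \<longlonglongrightarrow> f x" if x: "x \<in> topspace X" for x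
  proof (rule tendsto_eventually)
    obtain K where K: "\<bar>f x\<bar> \<le> real K"
      using real_arch_simple by blast
    show "eventually (\<lambda>k. u k x = f x) sequentially"
      using eventually_ge_at_top[of K]
    proof eventually_elim
      case (elim k)
      then have "\<bar>f x\<bar> \<le> real k"
        using K by linarith
      then show ?case
        using x by (auto simp: u_def)
    qed
  qed
  then have "limitin (Cp X) u f sequentially"
    using f uC unfolding Cp_def limitin_subtopology limitin_componentwise
    by (auto simp: C_space_def PiE_def)
  then have "limitin euclideanreal (\<phi> \<circ> u) (\<phi> f) sequentially"
    by (rule continuous_map_limit[OF cont])
  then have "(\<lambda>k. 0) \<longlonglongrightarrow> \<phi> f"
    by (simp add: o_def zero_u)
  then show ?thesis
    by (simp add: LIMSEQ_const_iff)
qed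

section \<open>Finite-dimensional subspaces of sequences\<close>

lemma finite_dimensional_subspace:
  assumes "subspace V" "finite S" "V \<subseteq> span S"
  shows "finite_dimensional V"
proof -
  obtain B where B: "B \<subseteq> V" "independent B" "V \<subseteq> span B"
    by (rule maximal_independent_subset)
  have "finite B"
    using independent_span_bound[OF assms(2) B(2)] B(1) assms(3) by blast
  moreover have "span B = V"
    using B span_minimal[OF B(1) assms(1)] by blast
  ultimately show ?thesis
    unfolding finite_dimensional_def by blast
qed

lemma sum_fun_apply: "(\<Sum>i\<in>A. F i) n = (\<Sum>i\<in>A. F i n)"
  for F :: "'i \<Rightarrow> 'b \<Rightarrow> 'c::comm_monoid_add"
  by (induction A rule: infinite_finite_induct) auto

lemma in_span_unit_sequences:
  fixes s :: "nat \<Rightarrow> real"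
  assumes "\<And>n. n \<ge> N \<Longrightarrow> s n = 0"
  shows "s \<in> span ((\<lambda>i n. if n = i then 1 else 0) ` {..<N})"
proof -
  have "s = (\<Sum>i<N. s i *\<^sub>R (\<lambda>n. if n = i then 1 else 0))"
    using assms by (auto simp: fun_eq_iff sum_fun_apply scaleR_fun_def if_distrib cong: if_cong)
  also have "\<dots> \<in> span ((\<lambda>i n. if n = i then 1 else 0) ` {..<N})"
    by (intro span_sum span_scale span_base) auto
  finally show ?thesis .
qed

lemma subspace_range:
  assumes "linear_on_C X T"
  shows "subspace (T ` C_space X)"
proof (rule subspaceI)
  have z: "(\<lambda>x\<in>topspace X. 0) \<in> C_space X"
    using zero_in_Cb[of X] unfolding mspace_Cb by blast
  have "T (C_scale X 0 (\<lambda>x\<in>topspace X. 0)) = 0"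
    using assms z unfolding linear_on_C_def by (metis scaleR_zero_left)
  then show "0 \<in> T ` C_space X"
    using C_scale_closed[OF z] by (metis imageI)
  show "a + b \<in> T ` C_space X" if ab: "a \<in> T ` C_space X" "b \<in> T ` C_space X" for a b
  proof -
    obtain f g where fg: "f \<in> C_space X" "g \<in> C_space X" "a = T f" "b = T g"
      using ab by blast
    then have "a + b = T (C_add X f g)"
      using assms unfolding linear_on_C_def by simp
    then show ?thesis
      using C_add_closed fg by blast
  qed
  show "c *\<^sub>R a \<in> T ` C_space X" if a: "a \<in> T ` C_space X" for c a
  proof -
    obtain f where f: "f \<in> C_space X" "a = T f"
      using a by blast
    then have "c *\<^sub>R a = T (C_scale X c f)"
      using assms unfolding linear_on_C_def by simp
    then show ?thesis
      using C_scale_closed f by blast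
  qed
qed

section \<open>Operators into the finitely supported sequences\<close>

theorem theorem1p3:
  fixes X :: "'a topology" and T :: "('a \<Rightarrow> real) \<Rightarrow> (nat \<Rightarrow> real)"
  assumes "tychonoff_space X"
    and "linear_on_C X T"
    and "continuous_map (Cp X) c00_p T"
  shows "finite_dimensional (T ` C_space X)"
proof -
  have lin: "linear_on_C X (\<lambda>f. T f n)" for n
    using assms(2) by (simp add: linear_on_C_def scaleR_fun_def)
  have cont: "continuous_map (Cp X) euclideanreal (\<lambda>f. T f n)" for n
    using assms(3) unfolding c00_p_def
    by (simp add: continuous_map_in_subtopology continuous_map_componentwise_UNIV)
  have "eventually (\<lambda>n. T f n = 0) sequentially" if "f \<in> C_space X" for f
  proof -
    have "T f \<in> c00"
      using assms(3) that by (auto simp: continuous_map_def)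
    then have "finite {n. T f n \<noteq> 0}"
      by (simp add: c00_def)
    then show ?thesis
      by (simp add: eventually_cofinite flip: cofinite_eq_sequentially)
  qed
  then have "\<exists>N. \<forall>n\<ge>N. \<forall>f\<in>mspace (Cb X). T f n = 0"
    unfolding mspace_Cb
    by (intro eventually_zero_on_bounded[OF lin cont, unfolded mspace_Cb]) auto
  then obtain N where "\<And>n f. n \<ge> N \<Longrightarrow> f \<in> mspace (Cb X) \<Longrightarrow> T f n = 0"
    by blast
  then have N: "T f n = 0" if "n \<ge> N" "f \<in> C_space X" for n f
    using zero_if_zero_on_bounded[OF cont] that by blast
  show ?thesis
  proof (rule finite_dimensional_subspace)
    show "subspace (T ` C_space X)"
      by (rule subspace_range[OF assms(2)])
    show "T ` C_space X \<subseteq> span ((\<lambda>i n. if n = i then 1 else 0) ` {..<N})"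
      using N by (auto intro: in_span_unit_sequences)
  qed simp
qed

end
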